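(* Let $A\in\mathbb{R}^{M\times N}$, $b\in\mathbb{R}^M$, $\ell\ge1$, $1\le k\le m$, and $\lambda\ge0$. Let $V_{m+\ell}$, $U_{m+\ell+1}$, $B_{m+\ell}$ be computed by $m+\ell$ iterations of standard Golub-Kahan bidiagonalization (GKB). Let $W_{k-1}\in\mathbb{R}^{N\times(k-1)}$ have orthonormal columns with $\mathcal{R}(W_{k-1})\subset\mathcal{R}(V_m)$, let $x^{(1)}\in\mathcal{R}(V_m)$, $x^{(1)}\notin\mathcal{R}(W_{k-1})$, and let $W_k$, $Y_k$, $R_k$, $\widetilde V_\ell$, $\widetilde U_{\ell+1}$, $\widetilde B_\ell$, $\widehat B_{k,\ell}$ come from $\ell$ iterations of recycling GKB. Let $T=[T_1\ T_2\ T_c]$ and $Z=[Z_1\ Z_2\ Z_c]$ be orthogonal matrices as in the context and let $\widehat r_\lambda$, $r_\lambda$ be the residuals defined in the context. Then $$r_\lambda=\begin{bmatrix}0\\ Z_c^\top B_{m+\ell}^\top[T_1\ T_2]\,\widehat r_\lambda\end{bmatrix},\qquad \|r_\lambda\|_2=\left\|Z_c^\top B_{m+\ell}^\top[T_1\ T_2]\,\widehat r_\lambda\right\|_2,$$ where the zero block has length $k+\ell$.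
   Context: Exact arithmetic and no breakdown are assumed: all normalization scalars $\alpha_j,\beta_j,\widetilde\alpha_j,\widetilde\beta_j$ generated below are nonzero. $\mathcal{R}(\cdot)$ is column space (inclusions not necessarily strict); $e_j$ is the $j$-th standard basis vector of the appropriate dimension. Standard GKB: $\beta_1=\|b\|_2$, $u_1=b/\beta_1$, $\alpha_1v_1=A^\top u_1$, and for $j\ge1$, $\beta_{j+1}u_{j+1}=Av_j-\alpha_ju_j$, $\alpha_{j+1}v_{j+1}=A^\top u_{j+1}-\beta_{j+1}v_j$, with the scalars being positive and normalizing the vectors to unit length. $V_n=[v_1\cdots v_n]$, $U_{n+1}=[u_1\cdots u_{n+1}]$ (orthonormal columns), and $B_n\in\mathbb{R}^{(n+1)\times n}$ is lower bidiagonal with $(B_n)_{j,j}=\alpha_j$, $(B_n)_{j+1,j}=\beta_{j+1}$; thus $AV_n=U_{n+1}B_n$. Recycling GKB: given $W_{k-1}$ with orthonormal columns and a vector $x^{(1)}\notin\mathcal{R}(W_{k-1})$, put $\check x^{(1)}=(x^{(1)}-W_{k-1}W_{k-1}^\top x^{(1)})/\|x^{(1)}-W_{k-1}W_{k-1}^\top x^{(1)}\|_2$ and $W_k=[W_{k-1}\ \check x^{(1)}]$. Let $AW_k=Y_kR_k$ be the skinny QR factorization ($Y_k\in\mathbb{R}^{M\times k}$ orthonormal columns, $R_k\in\mathbb{R}^{k\times k}$ upper triangular). Let $\check r^{(1)}=b-A\check x^{(1)}$, $\zeta=Y_k^\top\check r^{(1)}$, $\widetilde b=\check r^{(1)}-Y_k\zeta$,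 $\widetilde\beta_1=\|\widetilde b\|_2$, $\widetilde u_1=\widetilde b/\widetilde\beta_1$, $\widetilde\alpha_1\widetilde v_1=A^\top\widetilde u_1$, and for $j=1,\dots,\ell$: $\widetilde\beta_{j+1}\widetilde u_{j+1}=(I-Y_kY_k^\top)A\widetilde v_j-\widetilde\alpha_j\widetilde u_j$, $\widetilde\alpha_{j+1}\widetilde v_{j+1}=A^\top\widetilde u_{j+1}-\widetilde\beta_{j+1}\widetilde v_j$, with positive normalizing scalars. Put $\widetilde V_\ell=[\widetilde v_1\cdots\widetilde v_\ell]$, $\widetilde U_{\ell+1}=[\widetilde u_1\cdots\widetilde u_{\ell+1}]$, and let $\widetilde B_\ell\in\mathbb{R}^{(\ell+1)\times\ell}$ be lower bidiagonal with diagonal $\widetilde\alpha_j$ and subdiagonal $\widetilde\beta_{j+1}$. Set $$\widehat B_{k,\ell}=\begin{bmatrix}R_k & Y_k^\top A\widetilde V_\ell\\ 0&\widetilde B_\ell\end{bmatrix}\in\mathbb{R}^{(k+\ell+1)\times(k+\ell)}.$$ Orthogonal matrices: $T=[T_1\ T_2\ T_c]\in\mathbb{R}^{(m+\ell+1)\times(m+\ell+1)}$ and $Z=[Z_1\ Z_2\ Z_c]\in\mathbb{R}^{(m+\ell)\times(m+\ell)}$ are orthogonal with $Y_k=U_{m+\ell+1}T_1$, $\widetilde U_{\ell+1}=U_{m+\ell+1}T_2$, $W_k=V_{m+\ell}Z_1$, $\widetilde V_\ell=V_{m+\ell}Z_2$ (such matrices exist). Residuals: let $g=\begin{bmatrix}\zeta+R_ke_k\\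 \widetilde\beta_1e_1\end{bmatrix}\in\mathbb{R}^{k+\ell+1}$, let $\widetilde y_\lambda=\arg\min_y\|\widehat B_{k,\ell}y-g\|_2^2+\lambda^2\|y\|_2^2$, and $\widehat r_\lambda=g-\widehat B_{k,\ell}\widetilde y_\lambda$. With $G=T^\top B_{m+\ell}Z$, let $$r_\lambda=G^\top T^\top\beta_1e_1-(G^\top G+\lambda^2I)\begin{bmatrix}\widetilde y_\lambda\\0\end{bmatrix},$$ the residual of $[\widetilde y_\lambda^\top\ 0^\top]^\top$ in the normal equations of the transformed full Tikhonov problem. *)

theory Defs
  imports Complex_Main "Jordan_Normal_Form.VS_Connect"
begin

definition vnorm :: "real vec \<Rightarrow> real" where
  "vnorm v = sqrt (v \<bullet> v)"

(* Block row [A B]; blocks with zero columns are allowed. *)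
definition hcat :: "real mat \<Rightarrow> real mat \<Rightarrow> real mat" (infixr \<open>|||\<close> 65) where
  "A ||| B = four_block_mat A B (0\<^sub>m 0 (dim_col A)) (0\<^sub>m 0 (dim_col B))"

definition orthonormal_cols :: "real mat \<Rightarrow> bool" where
  "orthonormal_cols Q \<longleftrightarrow> transpose_mat Q * Q = 1\<^sub>m (dim_col Q)"

(* The library's orthogonal_mat does not normalize the columns, hence this notion. *)
definition orthogonal_matrix :: "nat \<Rightarrow> real mat \<Rightarrow> bool" where
  "orthogonal_matrix n Q \<longleftrightarrow> Q \<in> carrier_mat n n \<and>
     transpose_mat Q * Q = 1\<^sub>m n \<and> Q * transpose_mat Q = 1\<^sub>m n"

abbreviation col_range :: "real mat \<Rightarrow> real vec set" where
  "col_range Q \<equiv> vec_space.col_space (dim_row Q) Q"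

(* Sequences below are indexed from 1, as in the recurrences; index 0 is unused.
   Indices of vec and mat entries start at 0. *)

definition seq_cols :: "nat \<Rightarrow> (nat \<Rightarrow> real vec) \<Rightarrow> nat \<Rightarrow> real mat" where
  "seq_cols d w n = mat_of_cols d (map w [1..<n+1])"

definition lower_bidiag :: "(nat \<Rightarrow> real) \<Rightarrow> (nat \<Rightarrow> real) \<Rightarrow> nat \<Rightarrow> real mat" where
  "lower_bidiag \<alpha> \<beta> n = mat (n+1) n
     (\<lambda>(i, j). if i = j then \<alpha> (j+1) else if i = j+1 then \<beta> (j+2) else 0)"

(* n iterations of Golub-Kahan bidiagonalization without breakdown, producing
   u 1, ..., u (n+1) and v 1, ..., v n. The last half step, which would yield
   \<alpha> (n+1) and v (n+1), is not included since neither enters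
   the bidiagonal matrix or the bases; thus \<alpha> (n+1) may vanish. *)
definition gkb ::
  "real mat \<Rightarrow> real vec \<Rightarrow> nat \<Rightarrow>
   (nat \<Rightarrow> real vec) \<Rightarrow> (nat \<Rightarrow> real vec) \<Rightarrow> (nat \<Rightarrow> real) \<Rightarrow> (nat \<Rightarrow> real) \<Rightarrow> bool"
where
  "gkb A b n u v \<alpha> \<beta> \<longleftrightarrow>
     (\<forall>j\<in>{1..n+1}. u j \<in> carrier_vec (dim_row A) \<and> vnorm (u j) = 1 \<and> \<beta> j > 0) \<and>
     (\<forall>j\<in>{1..n}. v j \<in> carrier_vec (dim_col A) \<and> vnorm (v j) = 1 \<and> \<alpha> j > 0) \<and>
     \<beta> 1 = vnorm b \<and>
     u 1 = (1 / \<beta> 1) \<cdot>\<^sub>v b \<and>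
     \<alpha> 1 \<cdot>\<^sub>v v 1 = transpose_mat A *\<^sub>v u 1 \<and>
     (\<forall>j\<in>{1..n}. \<beta> (j+1) \<cdot>\<^sub>v u (j+1) = A *\<^sub>v v j - \<alpha> j \<cdot>\<^sub>v u j) \<and>
     (\<forall>j\<in>{1..<n}. \<alpha> (j+1) \<cdot>\<^sub>v v (j+1) = transpose_mat A *\<^sub>v u (j+1) - \<beta> (j+1) \<cdot>\<^sub>v v j)"

definition skinny_qr :: "real mat \<Rightarrow> real mat \<Rightarrow> real mat \<Rightarrow> bool" where
  "skinny_qr C Y R \<longleftrightarrow>
     Y \<in> carrier_mat (dim_row C) (dim_col C) \<and> orthonormal_cols Y \<and>
     R \<in> carrier_mat (dim_col C) (dim_col C) \<and> upper_triangular R \<and>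
     C = Y * R"

(* Normalized component of x orthogonal to the columns of W. *)
definition new_direction :: "real mat \<Rightarrow> real vec \<Rightarrow> real vec" where
  "new_direction W x =
     (let d = x - W *\<^sub>v (transpose_mat W *\<^sub>v x) in (1 / vnorm d) \<cdot>\<^sub>v d)"

(* l iterations of the recycling recurrences for a given Y, started from the
   residual r. As in gkb, the last half step is not included. *)
definition recycling_gkb ::
  "real mat \<Rightarrow> real mat \<Rightarrow> real vec \<Rightarrow> nat \<Rightarrow>
   (nat \<Rightarrow> real vec) \<Rightarrow> (nat \<Rightarrow> real vec) \<Rightarrow> (nat \<Rightarrow> real) \<Rightarrow> (nat \<Rightarrow> real) \<Rightarrow> bool"
where
  "recycling_gkb A Y r l u v \<alpha> \<beta> \<longleftrightarrow>
     (let bt = r - Y *\<^sub>v (transpose_mat Y *\<^sub>v r) in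
     (\<forall>j\<in>{1..l+1}. u j \<in> carrier_vec (dim_row A) \<and> vnorm (u j) = 1 \<and> \<beta> j > 0) \<and>
     (\<forall>j\<in>{1..l}. v j \<in> carrier_vec (dim_col A) \<and> vnorm (v j) = 1 \<and> \<alpha> j > 0) \<and>
     \<beta> 1 = vnorm bt \<and>
     u 1 = (1 / \<beta> 1) \<cdot>\<^sub>v bt \<and>
     \<alpha> 1 \<cdot>\<^sub>v v 1 = transpose_mat A *\<^sub>v u 1 \<and>
     (\<forall>j\<in>{1..l}. \<beta> (j+1) \<cdot>\<^sub>v u (j+1) =
        (1\<^sub>m (dim_row A) - Y * transpose_mat Y) *\<^sub>v (A *\<^sub>v v j) - \<alpha> j \<cdot>\<^sub>v u j) \<and>
     (\<forall>j\<in>{1..<l}. \<alpha> (j+1) \<cdot>\<^sub>v v (j+1) = transpose_mat A *\<^sub>v u (j+1) - \<beta> (j+1) \<cdot>\<^sub>v v j))"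

definition recycled_mat :: "real mat \<Rightarrow> real mat \<Rightarrow> real mat \<Rightarrow> real mat \<Rightarrow> real mat \<Rightarrow> real mat" where
  "recycled_mat A Y R Vt Bt =
     four_block_mat R (transpose_mat Y * A * Vt) (0\<^sub>m (dim_row Bt) (dim_col R)) Bt"

definition tikhonov_minimizer :: "real mat \<Rightarrow> real vec \<Rightarrow> real \<Rightarrow> real vec \<Rightarrow> bool" where
  "tikhonov_minimizer C g lam y \<longleftrightarrow>
     is_arg_min (\<lambda>z. (vnorm (C *\<^sub>v z - g))\<^sup>2 + lam\<^sup>2 * (vnorm z)\<^sup>2)
       (\<lambda>z. z \<in> carrier_vec (dim_col C)) y"

end

theory Submission
  imports Defs
begin

text \<open>
  Write \<open>P = [T1 T2]\<close> and \<open>Q = [Z1 Z2]\<close>. Everything follows from two identities that express the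
  recycled problem inside the full one:
  \<open>B Q = P Bh\<close> and \<open>P g = \<beta>\<^sub>1 e\<^sub>1\<close>.

  Both are obtained by multiplying with \<open>U\<close> and cancelling it afterwards, which is possible because
  the columns of \<open>U\<close> are orthonormal (\<open>gkb_left_orthonormal\<close>). For the first identity, \<open>A V = U B\<close>
  (\<open>gkb_factorization\<close>) turns \<open>U B Q\<close> into \<open>A V Q = A [W Vt]\<close>, and the QR factorization of \<open>A W\<close>
  together with the recycling recurrences (\<open>recycling_gkb_factorization\<close>) gives
  \<open>A [W Vt] = [Y Ut] Bh = U P Bh\<close>. For the second one,
  \<open>[Y Ut] g = Y \<zeta> + Y R e\<^sub>k + \<beta>t\<^sub>1 ut\<^sub>1 = (Y \<zeta> + (r\<^sub>1 - Y \<zeta>)) + A xc = r\<^sub>1 + A xc = b = U \<beta>\<^sub>1 e\<^sub>1\<close>,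
  since \<open>xc\<close> is the last column of \<open>W\<close>.

  Now the rest is linear algebra (\<open>residual_of_embedded_minimizer\<close>). As \<open>T\<close> is orthogonal, it drops
  out of the normal equations and the residual becomes \<open>Z\<^sup>T B\<^sup>T P rhat - \<lambda>\<^sup>2 [y; 0]\<close>. Its lower block
  is the one claimed. Its upper block is
  \<open>Q\<^sup>T B\<^sup>T P rhat - \<lambda>\<^sup>2 y = Bh\<^sup>T P\<^sup>T P rhat - \<lambda>\<^sup>2 y = Bh\<^sup>T rhat - \<lambda>\<^sup>2 y\<close>, which is zero because \<open>y\<close> solves
  the normal equations of the small Tikhonov problem (\<open>tikhonov_normal_equations\<close>).
\<close>

section \<open>Normal equations of Tikhonov regularization\<close>

lemma vnorm_sq: "(vnorm v)\<^sup>2 = v \<bullet> v"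
  unfolding vnorm_def by (simp add: scalar_prod_def sum_nonneg)

text \<open>
  The objective is a convex quadratic, and half its gradient at \<open>y\<close> is
  \<open>s = \<lambda>\<^sup>2 y + C\<^sup>T (C y - g)\<close>. If \<open>s\<close> were nonzero, a short step from \<open>y\<close> along \<open>-s\<close> would decrease
  the objective.
\<close>

lemma tikhonov_normal_equations:
  assumes C: "C \<in> carrier_mat p q" and g: "g \<in> carrier_vec p"
    and min: "tikhonov_minimizer C g lam y"
  shows "transpose_mat C *\<^sub>v (g - C *\<^sub>v y) = lam\<^sup>2 \<cdot>\<^sub>v y"
proof -
  define f where "f z = (vnorm (C *\<^sub>v z - g))\<^sup>2 + lam\<^sup>2 * (vnorm z)\<^sup>2" for z
  have le: "f y \<le> f z" if "z \<in> carrier_vec q" for z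
    using min C that by (auto simp: tikhonov_minimizer_def is_arg_min_linorder f_def)
  have y: "y \<in> carrier_vec q"
    using min C by (auto simp: tikhonov_minimizer_def is_arg_min_linorder)
  define e where "e = C *\<^sub>v y - g"
  define s where "s = lam\<^sup>2 \<cdot>\<^sub>v y + transpose_mat C *\<^sub>v e"
  have e: "e \<in> carrier_vec p" using C y g by (auto simp: e_def)
  have s: "s \<in> carrier_vec q" using C y e by (auto simp: s_def)
  have Cs: "C *\<^sub>v s \<in> carrier_vec p" using C s by auto
  have ss: "s \<bullet> s = lam\<^sup>2 * (y \<bullet> s) + e \<bullet> (C *\<^sub>v s)"
    unfolding s_def[THEN arg_cong, of "\<lambda>x. x \<bullet> s"]
    using transpose_vec_mult_scalar[OF C s e] C y e s
    by (subst add_scalar_prod_distrib[of _ q]) auto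
  define c where "c = (C *\<^sub>v s) \<bullet> (C *\<^sub>v s) + lam\<^sup>2 * (s \<bullet> s)"
  have c0: "c \<ge> 0" unfolding c_def by (metis vnorm_sq add_nonneg_nonneg mult_nonneg_nonneg zero_le_power2)
  have expand: "f (y + t \<cdot>\<^sub>v s) = f y + 2 * t * (s \<bullet> s) + t\<^sup>2 * c" for t
  proof -
    have 1: "C *\<^sub>v (y + t \<cdot>\<^sub>v s) - g = e + t \<cdot>\<^sub>v (C *\<^sub>v s)"
      using C y s g Cs mult_add_distrib_mat_vec[OF C y, of "t \<cdot>\<^sub>v s"] mult_mat_vec[OF C s, of t]
      by (auto simp: e_def)
    have 2: "(a + t \<cdot>\<^sub>v d) \<bullet> (a + t \<cdot>\<^sub>v d) = a \<bullet> a + 2 * t * (a \<bullet> d) + t\<^sup>2 * (d \<bullet> d)"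
      if "a \<in> carrier_vec n" "d \<in> carrier_vec n" for a d :: "real vec" and n
      using that comm_scalar_prod[OF that]
      by (simp add: add_scalar_prod_distrib[of _ n] scalar_prod_add_distrib[of _ n]
          power2_eq_square algebra_simps)
    show ?thesis
      unfolding f_def 1 unfolding vnorm_sq 2[OF e Cs] 2[OF y s] e_def[symmetric] c_def ss
      by (simp add: algebra_simps)
  qed
  have "s \<bullet> s = 0"
  proof (rule ccontr)
    assume "s \<bullet> s \<noteq> 0"
    then have pos: "s \<bullet> s > 0" by (metis vnorm_sq zero_le_power2 order_less_le)
    \<comment> \<open>The exact minimizer of the quadratic in \<open>t\<close> is \<open>- (s \<bullet> s) / c\<close>; the denominator \<open>c + 1\<close>
      also covers \<open>c = 0\<close>.\<close>
    define t where "t = - (s \<bullet> s) / (c + 1)"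
    have "t < 0" using pos c0 by (simp add: t_def divide_neg_pos)
    moreover have "0 \<le> t * (2 * (s \<bullet> s) + t * c)"
      using le[of "y + t \<cdot>\<^sub>v s"] y s expand[of t] by (simp add: power2_eq_square algebra_simps)
    ultimately have "2 * (s \<bullet> s) + t * c \<le> 0" by (simp add: zero_le_mult_iff)
    moreover have "t * c \<ge> - (s \<bullet> s)"
      using pos c0 by (simp add: t_def divide_simps) 
    ultimately show False using pos by linarith
  qed
  then have "s = 0\<^sub>v q"
    using conjugate_square_eq_0_vec[OF s] by simp
  then have "lam\<^sup>2 \<cdot>\<^sub>v y + transpose_mat C *\<^sub>v e = 0\<^sub>v q" by (simp add: s_def)
  then have "lam\<^sup>2 * y $ i + col C i \<bullet> e = 0" if "i < q" for i
    using C y e that by (auto simp: vec_eq_iff)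
  moreover have "g - C *\<^sub>v y = - e" using C y g by (auto simp: e_def)
  ultimately show ?thesis
    using C y e by (intro eq_vecI) (auto simp: add_eq_0_iff)
qed

section \<open>Golub-Kahan bidiagonalization\<close>

text \<open>
  The two recurrences solved for the matrix-vector product and tested against a vector \<open>x\<close>. The
  case distinction reflects that \<open>A\<^sup>T u\<^sub>1\<close> has no preceding \<open>v\<close>-term.
\<close>

lemma gkb_adjoint_recurrence:
  assumes A: "A \<in> carrier_mat M N" and gkb: "gkb A b n u v \<alpha> \<beta>"
    and i: "i \<in> {1..n}" and x: "x \<in> carrier_vec N"
  shows "(transpose_mat A *\<^sub>v u i) \<bullet> x = \<alpha> i * (v i \<bullet> x) + (if i = 1 then 0 else \<beta> i * (v (i-1) \<bullet> x))"
proof (cases "i = 1")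
  case True
  then have v: "v 1 \<in> carrier_vec N" and eq: "\<alpha> 1 \<cdot>\<^sub>v v 1 = transpose_mat A *\<^sub>v u 1"
    using gkb A i unfolding gkb_def by auto
  show ?thesis
    using True arg_cong[OF eq, of "\<lambda>z. z \<bullet> x"] v x by simp
next
  case False
  then obtain j where j: "i = j + 1" "j \<in> {1..<n}" using i by (cases i) auto
  have v: "v j \<in> carrier_vec N" "v (j+1) \<in> carrier_vec N" and u: "u (j+1) \<in> carrier_vec M"
    and eq: "\<alpha> (j+1) \<cdot>\<^sub>v v (j+1) = transpose_mat A *\<^sub>v u (j+1) - \<beta> (j+1) \<cdot>\<^sub>v v j"
    using gkb A j unfolding gkb_def by auto
  have "\<alpha> (j+1) * (v (j+1) \<bullet> x) = (transpose_mat A *\<^sub>v u (j+1)) \<bullet> x - \<beta> (j+1) * (v j \<bullet> x)"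
    using arg_cong[OF eq, of "\<lambda>z. z \<bullet> x"] A v u x by (simp add: minus_scalar_prod_distrib[of _ N])
  then show ?thesis using j by simp
qed

lemma gkb_recurrence:
  assumes A: "A \<in> carrier_mat M N" and gkb: "gkb A b n u v \<alpha> \<beta>"
    and i: "i \<in> {1..n}" and x: "x \<in> carrier_vec M"
  shows "(A *\<^sub>v v i) \<bullet> x = \<alpha> i * (u i \<bullet> x) + \<beta> (i+1) * (u (i+1) \<bullet> x)"
proof -
  have v: "v i \<in> carrier_vec N" and u: "u i \<in> carrier_vec M" "u (i+1) \<in> carrier_vec M"
    and eq: "\<beta> (i+1) \<cdot>\<^sub>v u (i+1) = A *\<^sub>v v i - \<alpha> i \<cdot>\<^sub>v u i"
    using gkb A i unfolding gkb_def by auto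
  show ?thesis
    using arg_cong[OF eq, of "\<lambda>z. z \<bullet> x"] A v u x by (simp add: minus_scalar_prod_distrib[of _ M])
qed

text \<open>
  Orthogonality is inherited alternately by the two sequences. A new vector \<open>v\<^bsub>k+1\<^esub>\<close> is a
  combination of \<open>A\<^sup>T u\<^bsub>k+1\<^esub>\<close> and \<open>v\<^sub>k\<close>; moving \<open>A\<^sup>T\<close> to the other side of the inner product with
  \<open>v\<^sub>i\<close> gives \<open>A v\<^sub>i\<close>, a combination of \<open>u\<^sub>i\<close> and \<open>u\<^bsub>i+1\<^esub>\<close>, which is orthogonal to \<open>u\<^bsub>k+1\<^esub>\<close>
  unless \<open>i = k\<close>, where the subtracted multiple of \<open>v\<^sub>k\<close> compensates. A new \<open>u\<^bsub>k+2\<^esub>\<close> is treated in the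
  same way, using the orthogonality of \<open>v\<^bsub>k+1\<^esub>\<close> just obtained. Hence both claims are proved in
  one induction.
\<close>

lemma gkb_orthogonal:
  assumes A: "A \<in> carrier_mat M N" and gkb: "gkb A b n u v \<alpha> \<beta>" and "k \<le> n"
  shows "(\<forall>i\<in>{1..k+1}. \<forall>j\<in>{1..k+1}. i < j \<longrightarrow> u i \<bullet> u j = 0) \<and>
         (\<forall>i\<in>{1..k}. \<forall>j\<in>{1..k}. i < j \<longrightarrow> v i \<bullet> v j = 0)"
  using \<open>k \<le> n\<close>
proof (induction k)
  case 0
  then show ?case by auto
next
  case (Suc k)
  have uc: "u i \<in> carrier_vec M" and u1: "u i \<bullet> u i = 1" and b0: "\<beta> i > 0" if "i \<in> {1..n+1}" for i
    using gkb A that vnorm_sq[of "u i"] unfolding gkb_def by auto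
  have vc: "v i \<in> carrier_vec N" and v1: "v i \<bullet> v i = 1" and a0: "\<alpha> i > 0" if "i \<in> {1..n}" for i
    using gkb A that vnorm_sq[of "v i"] unfolding gkb_def by auto
  have IHu: "u i \<bullet> u j = 0" if "i \<in> {1..k+1}" "j \<in> {1..k+1}" "i < j" for i j
    using Suc that by auto
  have IHv: "v i \<bullet> v j = 0" if "i \<in> {1..k}" "j \<in> {1..k}" "i < j" for i j
    using Suc that by auto
  have v_new: "v i \<bullet> v (k+1) = 0" if i: "i \<in> {1..k}" for i
  proof -
    have c: "v i \<in> carrier_vec N" "v (k+1) \<in> carrier_vec N" "u (k+1) \<in> carrier_vec M" 
      using i Suc.prems vc uc by auto
    have "(transpose_mat A *\<^sub>v u (k+1)) \<bullet> v i = \<alpha> (k+1) * (v (k+1) \<bullet> v i) + \<beta> (k+1) * (v k \<bullet> v i)"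
      using gkb_adjoint_recurrence[OF A gkb, of "k+1" "v i"] i Suc.prems c by auto
    moreover have "(transpose_mat A *\<^sub>v u (k+1)) \<bullet> v i = (A *\<^sub>v v i) \<bullet> u (k+1)"
      using transpose_vec_mult_scalar[OF A c(1,3)] comm_scalar_prod[of "u (k+1)" M "A *\<^sub>v v i"] A c by auto
    moreover have "(A *\<^sub>v v i) \<bullet> u (k+1) = \<alpha> i * (u i \<bullet> u (k+1)) + \<beta> (i+1) * (u (i+1) \<bullet> u (k+1))"
      using gkb_recurrence[OF A gkb, of i "u (k+1)"] i Suc.prems c by auto
    moreover have "u i \<bullet> u (k+1) = 0" using IHu i by auto
    moreover have "\<beta> (i+1) * (u (i+1) \<bullet> u (k+1)) = \<beta> (k+1) * (v k \<bullet> v i)"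
    proof (cases "i = k")
      case True then show ?thesis using u1 v1 i Suc.prems by auto
    next
      case False
      then have "v i \<bullet> v k = 0" "u (i+1) \<bullet> u (k+1) = 0" using i IHu IHv by auto
      then show ?thesis using comm_scalar_prod[of "v i" N "v k"] vc i Suc.prems by auto
    qed
    ultimately have "\<alpha> (k+1) * (v (k+1) \<bullet> v i) = 0" by simp
    then show ?thesis using a0[of "k+1"] Suc.prems comm_scalar_prod[OF c(1,2)] by auto
  qed
  have u_new: "u i \<bullet> u (k+2) = 0" if i: "i \<in> {1..k+1}" for i
  proof -
    have c: "u i \<in> carrier_vec M" "v (k+1) \<in> carrier_vec N" "u (k+1) \<in> carrier_vec M" "u (k+2) \<in> carrier_vec M"
      using i Suc.prems vc uc by auto
    have "(A *\<^sub>v v (k+1)) \<bullet> u i = \<alpha> (k+1) * (u (k+1) \<bullet> u i) + \<beta> (k+2) * (u (k+2) \<bullet> u i)"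
      using gkb_recurrence[OF A gkb, of "k+1" "u i"] i Suc.prems c by auto
    moreover have "(A *\<^sub>v v (k+1)) \<bullet> u i = (transpose_mat A *\<^sub>v u i) \<bullet> v (k+1)"
      using transpose_vec_mult_scalar[OF A c(2,1)] comm_scalar_prod[of "u i" M "A *\<^sub>v v (k+1)"] A c by auto
    moreover have "(transpose_mat A *\<^sub>v u i) \<bullet> v (k+1)
        = \<alpha> i * (v i \<bullet> v (k+1)) + (if i = 1 then 0 else \<beta> i * (v (i-1) \<bullet> v (k+1)))"
      using gkb_adjoint_recurrence[OF A gkb, of i "v (k+1)"] i Suc.prems c by auto
    moreover have "(if i = 1 then 0 else \<beta> i * (v (i-1) \<bullet> v (k+1))) = 0"
    proof (cases "i = 1")
      case False
      then have "i - 1 \<in> {1..k}" using i by auto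
      then show ?thesis using v_new[of "i-1"] by simp
    qed simp
    moreover have "\<alpha> i * (v i \<bullet> v (k+1)) = \<alpha> (k+1) * (u (k+1) \<bullet> u i)"
    proof (cases "i = k+1")
      case True then show ?thesis using u1 v1 i Suc.prems by auto
    next
      case False
      then have "v i \<bullet> v (k+1) = 0" "u i \<bullet> u (k+1) = 0" using i IHu v_new by auto
      then show ?thesis using comm_scalar_prod[OF c(1,3)] by auto
    qed
    ultimately have "\<beta> (k+2) * (u (k+2) \<bullet> u i) = 0" by simp
    then show ?thesis using b0[of "k+2"] Suc.prems comm_scalar_prod[OF c(1,4)] by auto
  qed
  have s: "{1..Suc k + 1} = insert (k+2) {1..k+1}" "{1..Suc k} = insert (k+1) {1..k}" by auto
  show ?case unfolding s using IHu IHv u_new v_new by auto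
qed

lemma gkb_left_orthonormal:
  assumes A: "A \<in> carrier_mat M N" and gkb: "gkb A b n u v \<alpha> \<beta>"
  shows "orthonormal_cols (seq_cols M u (n+1))"
proof -
  have uc: "u i \<in> carrier_vec M" and u1: "u i \<bullet> u i = 1" if "i \<in> {1..n+1}" for i
    using gkb A that vnorm_sq[of "u i"] unfolding gkb_def by auto
  have "u i \<bullet> u j = (if i = j then 1 else 0)" if "i \<in> {1..n+1}" "j \<in> {1..n+1}" for i j
    using that gkb_orthogonal[OF A gkb order_refl] u1[of i] comm_scalar_prod[OF uc uc, of i j]
    by (cases i j rule: linorder_cases) auto
  then show ?thesis using uc
    unfolding orthonormal_cols_def seq_cols_def 
    by (intro eq_matI) (auto simp del: upt_Suc)
qed

lemma col_seq_cols:
  assumes "j < n" "w (j+1) \<in> carrier_vec d"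
  shows "col (seq_cols d w n) j = w (j+1)"
  using assms unfolding seq_cols_def by (simp del: upt_Suc add: nth_upt)

lemma seq_cols_carrier[simp]: "seq_cols d w n \<in> carrier_mat d n"
  "dim_row (seq_cols d w n) = d" "dim_col (seq_cols d w n) = n"
  unfolding seq_cols_def by auto

lemma lower_bidiag_carrier: "lower_bidiag \<alpha> \<beta> n \<in> carrier_mat (n+1) n"
  unfolding lower_bidiag_def by auto

section \<open>Matrix form of the recurrences\<close>

lemma mult_unit_vec:
  fixes X :: "real mat"
  assumes "X \<in> carrier_mat p q" "i < q"
  shows "X *\<^sub>v unit_vec q i = col X i"
  using assms by (intro eq_vecI) auto

lemma seq_cols_mult_unit_vec:
  assumes "j < n" "w (j+1) \<in> carrier_vec d"
  shows "seq_cols d w n *\<^sub>v unit_vec n j = w (j+1)"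
  using mult_unit_vec[of "seq_cols d w n" d n j] col_seq_cols[of j n w d] assms by simp

lemma col_seq_cols_mult_lower_bidiag:
  assumes "j < n" "\<And>i. i \<in> {1..n+1} \<Longrightarrow> w i \<in> carrier_vec d"
  shows "col (seq_cols d w (n+1) * lower_bidiag \<alpha> \<beta> n) j
     = \<alpha> (j+1) \<cdot>\<^sub>v w (j+1) + \<beta> (j+2) \<cdot>\<^sub>v w (j+2)"
proof -
  have X: "seq_cols d w (n+1) \<in> carrier_mat d (n+1)" by simp
  have cB: "col (lower_bidiag \<alpha> \<beta> n) j = \<alpha> (j+1) \<cdot>\<^sub>v unit_vec (n+1) j + \<beta> (j+2) \<cdot>\<^sub>v unit_vec (n+1) (j+1)"
    using assms(1) by (intro eq_vecI) (auto simp: lower_bidiag_def)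
  have unit: "seq_cols d w (n+1) *\<^sub>v unit_vec (n+1) i = w (i+1)" if "i < n+1" for i
    using seq_cols_mult_unit_vec[of i "n+1" w d] assms that by auto
  have "col (seq_cols d w (n+1) * lower_bidiag \<alpha> \<beta> n) j
      = \<alpha> (j+1) \<cdot>\<^sub>v (seq_cols d w (n+1) *\<^sub>v unit_vec (n+1) j)
      + \<beta> (j+2) \<cdot>\<^sub>v (seq_cols d w (n+1) *\<^sub>v unit_vec (n+1) (j+1))"
    unfolding col_mult2[OF X lower_bidiag_carrier assms(1)] cB
    by (subst mult_add_distrib_mat_vec[OF X]) (simp_all only: mult_mat_vec[OF X] unit_vec_carrier smult_carrier_vec)
  then show ?thesis using unit[of j] unit[of "j+1"] assms(1) by simp
qed


lemma gkb_factorization: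
  assumes A: "A \<in> carrier_mat M N" and gkb: "gkb A b n u v \<alpha> \<beta>"
  shows "A * seq_cols N v n = seq_cols M u (n+1) * lower_bidiag \<alpha> \<beta> n"
proof (rule mat_col_eqI)
  show "dim_row (A * seq_cols N v n) = dim_row (seq_cols M u (n+1) * lower_bidiag \<alpha> \<beta> n)"
    "dim_col (A * seq_cols N v n) = dim_col (seq_cols M u (n+1) * lower_bidiag \<alpha> \<beta> n)"
    using A lower_bidiag_carrier[of \<alpha> \<beta> n] by auto
  fix j assume "j < dim_col (seq_cols M u (n+1) * lower_bidiag \<alpha> \<beta> n)"
  then have j: "j < n" using lower_bidiag_carrier[of \<alpha> \<beta> n] by auto
  have uc: "u i \<in> carrier_vec M" if "i \<in> {1..n+1}" for i
    using gkb A that unfolding gkb_def by auto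
  have v: "v (j+1) \<in> carrier_vec N"
    and eq: "\<beta> (j+2) \<cdot>\<^sub>v u (j+2) = A *\<^sub>v v (j+1) - \<alpha> (j+1) \<cdot>\<^sub>v u (j+1)"
    using gkb A j unfolding gkb_def by (auto simp: Ball_def)
  have "A *\<^sub>v v (j+1) = \<alpha> (j+1) \<cdot>\<^sub>v u (j+1) + \<beta> (j+2) \<cdot>\<^sub>v u (j+2)"
    unfolding eq using A v uc[of "j+1"] j by (intro eq_vecI) auto
  then show "col (A * seq_cols N v n) j = col (seq_cols M u (n+1) * lower_bidiag \<alpha> \<beta> n) j"
    using col_seq_cols_mult_lower_bidiag[OF j uc, where \<alpha> = \<alpha> and \<beta> = \<beta>] col_seq_cols[OF j, of v, OF v] 
      col_mult2[OF A seq_cols_carrier(1) j, of v] by simp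
qed

text \<open>
  The recycling recurrence is the Golub-Kahan recurrence for \<open>(I - Y Y\<^sup>T) A\<close> in its first half; the
  part \<open>Y Y\<^sup>T A\<close> that was projected away reappears as the first summand.
\<close>

lemma recycling_gkb_factorization:
  assumes A: "A \<in> carrier_mat M N" and Y: "Y \<in> carrier_mat M k"
    and rgkb: "recycling_gkb A Y r n u v \<alpha> \<beta>"
  shows "A * seq_cols N v n =
    Y * (transpose_mat Y * A * seq_cols N v n) + seq_cols M u (n+1) * lower_bidiag \<alpha> \<beta> n"
    (is "?L = ?R1 + ?R2")
proof (rule mat_col_eqI)
  have c1: "?R1 \<in> carrier_mat M n" 
    using Y by (meson A mult_carrier_mat seq_cols_carrier(1) transpose_carrier_mat)
  have c2: "?R2 \<in> carrier_mat M n"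
    using lower_bidiag_carrier[of \<alpha> \<beta> n] by auto
  show "dim_row ?L = dim_row (?R1 + ?R2)" "dim_col ?L = dim_col (?R1 + ?R2)"
    using A c1 c2 by auto
  fix j assume "j < dim_col (?R1 + ?R2)"
  then have j: "j < n" using c2 by auto
  have uc: "u i \<in> carrier_vec M" if "i \<in> {1..n+1}" for i
    using rgkb A that unfolding recycling_gkb_def Let_def by auto
  have v: "v (j+1) \<in> carrier_vec N"
    and eq: "\<beta> (j+2) \<cdot>\<^sub>v u (j+2) =
      (1\<^sub>m M - Y * transpose_mat Y) *\<^sub>v (A *\<^sub>v v (j+1)) - \<alpha> (j+1) \<cdot>\<^sub>v u (j+1)"
    using rgkb A j unfolding recycling_gkb_def Let_def by (auto simp: Ball_def)
  have Av: "A *\<^sub>v v (j+1) \<in> carrier_vec M" using A v by auto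
  have Yt: "transpose_mat Y \<in> carrier_mat k M" using Y by auto
  have proj: "(1\<^sub>m M - Y * transpose_mat Y) *\<^sub>v (A *\<^sub>v v (j+1))
      = A *\<^sub>v v (j+1) - Y *\<^sub>v (transpose_mat Y *\<^sub>v (A *\<^sub>v v (j+1)))"
    using minus_mult_distrib_mat_vec[of "1\<^sub>m M" M M "Y * transpose_mat Y"] Y Av
      assoc_mult_mat_vec[OF Y Yt Av] by auto
  have YAv: "Y *\<^sub>v (transpose_mat Y *\<^sub>v (A *\<^sub>v v (j+1))) \<in> carrier_vec M"
    using Y Yt Av by (metis mult_mat_vec_carrier)
  have "A *\<^sub>v v (j+1) = Y *\<^sub>v (transpose_mat Y *\<^sub>v (A *\<^sub>v v (j+1)))
      + (\<alpha> (j+1) \<cdot>\<^sub>v u (j+1) + \<beta> (j+2) \<cdot>\<^sub>v u (j+2))"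
    unfolding eq proj using A Y Av YAv uc[of "j+1"] j by (intro eq_vecI) auto
  moreover have "col ?R1 j = Y *\<^sub>v (transpose_mat Y *\<^sub>v (A *\<^sub>v v (j+1)))"
  proof -
    have YA: "transpose_mat Y * A \<in> carrier_mat k N" using Y A by auto
    have YAV: "transpose_mat Y * A * seq_cols N v n \<in> carrier_mat k n" using YA by auto
    show ?thesis
      using col_mult2[OF Y YAV j] col_mult2[OF YA seq_cols_carrier(1) j, of v] 
        col_seq_cols[OF j, of v, OF v] assoc_mult_mat_vec[OF Yt A v] by simp
  qed
  moreover have "col (?R1 + ?R2) j = col ?R1 j + col ?R2 j"
    using c1 c2 j by (intro eq_vecI) auto
  moreover have "col ?L j = A *\<^sub>v v (j+1)"
    using col_seq_cols[OF j, of v, OF v] col_mult2[OF A seq_cols_carrier(1) j, of v] by simp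
  ultimately show "col ?L j = col (?R1 + ?R2) j"
    using col_seq_cols_mult_lower_bidiag[OF j uc, where \<alpha> = \<alpha> and \<beta> = \<beta>] by simp
qed

section \<open>Block rows and orthonormal columns\<close>

lemma hcat_carrier:
  "X \<in> carrier_mat p q1 \<Longrightarrow> X' \<in> carrier_mat p q2 \<Longrightarrow> X ||| X' \<in> carrier_mat p (q1 + q2)"
  unfolding hcat_def by (auto intro!: carrier_matI)

lemma hcat_assoc:
  assumes "X \<in> carrier_mat p q1" "X' \<in> carrier_mat p q2" "X'' \<in> carrier_mat p q3"
  shows "X ||| X' ||| X'' = (X ||| X') ||| X''"
  using assms unfolding hcat_def by (intro eq_matI) (auto simp: algebra_simps)

lemma hcat_mult_four_block:
  assumes X: "X \<in> carrier_mat p q1" "X' \<in> carrier_mat p q2"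
    and F: "F1 \<in> carrier_mat q1 c1" "F2 \<in> carrier_mat q1 c2"
      "F3 \<in> carrier_mat q2 c1" "F4 \<in> carrier_mat q2 c2"
  shows "(X ||| X') * four_block_mat F1 F2 F3 F4 = (X * F1 + X' * F3) ||| (X * F2 + X' * F4)"
proof -
  have "dim_col X = q1" "dim_col X' = q2" using X by auto
  then have "(X ||| X') * four_block_mat F1 F2 F3 F4 =
    four_block_mat (X * F1 + X' * F3) (X * F2 + X' * F4)
     (0\<^sub>m 0 q1 * F1 + 0\<^sub>m 0 q2 * F3) (0\<^sub>m 0 q1 * F2 + 0\<^sub>m 0 q2 * F4)"
    unfolding hcat_def using mult_four_block_mat[OF X zero_carrier_mat zero_carrier_mat F, of 0] by simp
  then show ?thesis using X F unfolding hcat_def by auto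
qed

lemma mult_hcat:
  assumes C: "C \<in> carrier_mat n p" and X: "X \<in> carrier_mat p q1" "X' \<in> carrier_mat p q2"
  shows "C * (X ||| X') = C * X ||| C * X'"
proof (rule mat_col_eqI)
  show "dim_row (C * (X ||| X')) = dim_row (C * X ||| C * X')"
    "dim_col (C * (X ||| X')) = dim_col (C * X ||| C * X')"
    using C X by (auto simp: hcat_def)
  fix j assume "j < dim_col (C * X ||| C * X')"
  then show "col (C * (X ||| X')) j = col (C * X ||| C * X') j"
    using C X by (intro eq_vecI) (auto simp: hcat_def scalar_prod_def)
qed

lemma hcat_mult_append:
  assumes X: "X \<in> carrier_mat p q1" "X' \<in> carrier_mat p q2"
    and x: "x \<in> carrier_vec q1" "x' \<in> carrier_vec q2"
  shows "(X ||| X') *\<^sub>v (x @\<^sub>v x') = X *\<^sub>v x + X' *\<^sub>v x'"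
proof -
  have "dim_col X = q1" "dim_col X' = q2" using X by auto
  then have "(X ||| X') *\<^sub>v (x @\<^sub>v x') = (X *\<^sub>v x + X' *\<^sub>v x') @\<^sub>v (0\<^sub>m 0 q1 *\<^sub>v x + 0\<^sub>m 0 q2 *\<^sub>v x')"
    unfolding hcat_def using four_block_mat_mult_vec[OF X zero_carrier_mat zero_carrier_mat x, of 0] by simp
  then show ?thesis using X x by (intro eq_vecI) auto
qed

lemma transpose_hcat_mult:
  assumes X: "X \<in> carrier_mat p q1" "X' \<in> carrier_mat p q2" and x: "x \<in> carrier_vec p"
  shows "transpose_mat (X ||| X') *\<^sub>v x = (transpose_mat X *\<^sub>v x) @\<^sub>v (transpose_mat X' *\<^sub>v x)"
  using assms by (intro eq_vecI) (auto simp: hcat_def scalar_prod_def)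

text \<open>
  The entries of a Gram matrix are inner products of columns, so the Gram matrix of \<open>X\<close> is the
  leading block of that of \<open>[X X']\<close>.
\<close>

lemma orthonormal_cols_hcatD:
  assumes X: "X \<in> carrier_mat p q1" "X' \<in> carrier_mat p q2" and on: "orthonormal_cols (X ||| X')"
  shows "orthonormal_cols X"
  unfolding orthonormal_cols_def
proof (rule eq_matI)
  fix i j assume "i < dim_row (1\<^sub>m (dim_col X))" "j < dim_col (1\<^sub>m (dim_col X))"
  then have ij: "i < q1" "j < q1" using X by auto
  have C: "X ||| X' \<in> carrier_mat p (q1+q2)" using X by (rule hcat_carrier)
  have "col (X ||| X') n = col X n" if "n < q1" for n
    using X that by (intro eq_vecI) (auto simp: hcat_def)
  then have "col X i \<bullet> col X j = col (X ||| X') i \<bullet> col (X ||| X') j" using ij by simp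
  also have "\<dots> = (transpose_mat (X ||| X') * (X ||| X')) $$ (i, j)" using C ij by simp
  also have "\<dots> = 1\<^sub>m (dim_col (X ||| X')) $$ (i, j)" using on by (simp add: orthonormal_cols_def)
  finally show "(transpose_mat X * X) $$ (i, j) = 1\<^sub>m (dim_col X) $$ (i, j)"
    using C X ij by simp
qed auto

lemma orthonormal_cols_cancel:
  assumes U: "U \<in> carrier_mat p q" "orthonormal_cols U"
    and XX: "X \<in> carrier_mat q n" "X' \<in> carrier_mat q n" "U * X = U * X'"
  shows "X = X'"
proof -
  have "Z = transpose_mat U * (U * Z)" if "Z \<in> carrier_mat q n" for Z
    using U that assoc_mult_mat[of "transpose_mat U" q p U q Z n] by (auto simp: orthonormal_cols_def)
  then show ?thesis using XX by metis
qed

lemma orthonormal_cols_cancel_vec: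
  assumes U: "U \<in> carrier_mat p q" "orthonormal_cols U"
    and xx: "x \<in> carrier_vec q" "x' \<in> carrier_vec q" "U *\<^sub>v x = U *\<^sub>v x'"
  shows "x = x'"
proof -
  have "z = transpose_mat U *\<^sub>v (U *\<^sub>v z)" if "z \<in> carrier_vec q" for z
    using U that assoc_mult_mat_vec[of "transpose_mat U" q p U q z] by (auto simp: orthonormal_cols_def)
  then show ?thesis using xx by metis
qed


lemma orthogonal_matrix_hcatD:
  assumes X: "X \<in> carrier_mat n q1" "X' \<in> carrier_mat n q2" and orth: "orthogonal_matrix n (X ||| X')"
  shows "orthonormal_cols X"
proof -
  have "dim_col (X ||| X') = n" using orth by (auto simp: orthogonal_matrix_def)
  then have "orthonormal_cols (X ||| X')" using orth by (auto simp: orthogonal_matrix_def orthonormal_cols_def)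
  with X show ?thesis by (rule orthonormal_cols_hcatD)
qed

section \<open>The residual in the full problem\<close>

text \<open>
  The identity \<open>B Q = P C\<close> says that \<open>B\<close>, restricted to the range of \<open>Q\<close>, acts as \<open>C\<close> in the
  coordinates given by \<open>Q\<close> and \<open>P\<close>, and the data \<open>P g\<close> lies in the range of \<open>P\<close>. Therefore a
  solution of the small normal equations, padded by zeros, violates the large ones only in the
  directions of \<open>Zc\<close>.
\<close>

lemma residual_of_embedded_minimizer:
  fixes B C P Q Tc Zc :: "real mat"
  assumes B: "B \<in> carrier_mat p q"
    and P: "P \<in> carrier_mat p p1" "Tc \<in> carrier_mat p p2" "orthogonal_matrix p (P ||| Tc)"
    and Q: "Q \<in> carrier_mat q q1" "Zc \<in> carrier_mat q q2" "orthogonal_matrix q (Q ||| Zc)"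
    and C: "C \<in> carrier_mat p1 q1" "B * Q = P * C"
    and g: "g \<in> carrier_vec p1" and y: "y \<in> carrier_vec q1"
    and normal: "transpose_mat C *\<^sub>v (g - C *\<^sub>v y) = \<mu> \<cdot>\<^sub>v y"
    and G: "G = transpose_mat (P ||| Tc) * B * (Q ||| Zc)"
  shows "transpose_mat G *\<^sub>v (transpose_mat (P ||| Tc) *\<^sub>v (P *\<^sub>v g))
      - (transpose_mat G * G + \<mu> \<cdot>\<^sub>m 1\<^sub>m q) *\<^sub>v (y @\<^sub>v 0\<^sub>v q2)
    = 0\<^sub>v q1 @\<^sub>v ((transpose_mat Zc * transpose_mat B * P) *\<^sub>v (g - C *\<^sub>v y))"
proof -
  define T where "T = P ||| Tc"
  define Z where "Z = Q ||| Zc"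
  define rhat where "rhat = g - C *\<^sub>v y"
  have cancel: "(\<mu> \<cdot>\<^sub>v y @\<^sub>v w) - \<mu> \<cdot>\<^sub>v (y @\<^sub>v 0\<^sub>v q2) = 0\<^sub>v q1 @\<^sub>v w"
    if "w \<in> carrier_vec q2" for w
    using y that by (intro eq_vecI) auto
  have T: "T \<in> carrier_mat p p" "transpose_mat T \<in> carrier_mat p p" "T * transpose_mat T = 1\<^sub>m p"
    using P by (auto simp: T_def orthogonal_matrix_def)
  have Z: "Z \<in> carrier_mat q q" "transpose_mat Z \<in> carrier_mat q q"
    using Q by (auto simp: Z_def orthogonal_matrix_def)
  have q: "q1 + q2 = q" using hcat_carrier[OF Q(1,2)] Z by (auto simp: Z_def)
  have rhat: "rhat \<in> carrier_vec p1" using C g y by (auto simp: rhat_def)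
  have Bt: "transpose_mat B \<in> carrier_mat q p" using B by simp
  have TtB: "transpose_mat T * B \<in> carrier_mat p q" using T B by simp
  have G': "G = transpose_mat T * B * Z" unfolding G T_def Z_def ..
  have Gc: "G \<in> carrier_mat p q" unfolding G' using T B Z by simp
  have y0: "y @\<^sub>v 0\<^sub>v q2 \<in> carrier_vec q" using y q by auto
  have Pg: "P *\<^sub>v g \<in> carrier_vec p" and PCy: "P *\<^sub>v (C *\<^sub>v y) \<in> carrier_vec p"
    and Pr: "P *\<^sub>v rhat \<in> carrier_vec p" 
    using P by (auto intro!: carrier_vecI)
  have Gt: "transpose_mat G *\<^sub>v (transpose_mat T *\<^sub>v w) = transpose_mat Z *\<^sub>v (transpose_mat B *\<^sub>v w)"
    if w: "w \<in> carrier_vec p" for w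
  proof -
    have "transpose_mat G = transpose_mat Z * (transpose_mat B * T)"
      unfolding G' using transpose_mult[OF TtB Z(1)] transpose_mult[OF T(2) B] by simp
    also have "\<dots> *\<^sub>v (transpose_mat T *\<^sub>v w) = transpose_mat Z *\<^sub>v (transpose_mat B *\<^sub>v (T *\<^sub>v (transpose_mat T *\<^sub>v w)))"
      using T Z Bt w by (simp add: assoc_mult_mat_vec[of _ q q _ p] assoc_mult_mat_vec[of _ q p _ p])
    also have "T *\<^sub>v (transpose_mat T *\<^sub>v w) = w"
      using assoc_mult_mat_vec[OF T(1,2) w] T(3) w by simp
    finally show ?thesis .
  qed
  have Zy: "Z *\<^sub>v (y @\<^sub>v 0\<^sub>v q2) = Q *\<^sub>v y"
    unfolding Z_def using hcat_mult_append[OF Q(1,2) y, of "0\<^sub>v q2"] Q y by auto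
  have BQy: "B *\<^sub>v (Q *\<^sub>v y) = P *\<^sub>v (C *\<^sub>v y)"
    using assoc_mult_mat_vec[OF B Q(1) y] assoc_mult_mat_vec[OF P(1) C(1) y] C(2) by simp
  have Gy: "G *\<^sub>v (y @\<^sub>v 0\<^sub>v q2) = transpose_mat T *\<^sub>v (P *\<^sub>v (C *\<^sub>v y))"
    unfolding G' using assoc_mult_mat_vec[OF TtB Z(1) y0] assoc_mult_mat_vec[OF T(2) B, of "Q *\<^sub>v y"] Zy BQy Q y 
    by auto
  have "row (\<mu> \<cdot>\<^sub>m 1\<^sub>m q) i = \<mu> \<cdot>\<^sub>v unit_vec q i" if "i < q" for i
    using that by (intro eq_vecI) auto
  then have \<mu>y: "(\<mu> \<cdot>\<^sub>m 1\<^sub>m q) *\<^sub>v (y @\<^sub>v 0\<^sub>v q2) = \<mu> \<cdot>\<^sub>v (y @\<^sub>v 0\<^sub>v q2)"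
    using y0 by (intro eq_vecI) (simp_all add: scalar_prod_left_unit del: index_append_vec)
  have "(transpose_mat G * G + \<mu> \<cdot>\<^sub>m 1\<^sub>m q) *\<^sub>v (y @\<^sub>v 0\<^sub>v q2) =
      transpose_mat Z *\<^sub>v (transpose_mat B *\<^sub>v (P *\<^sub>v (C *\<^sub>v y))) + \<mu> \<cdot>\<^sub>v (y @\<^sub>v 0\<^sub>v q2)"
    using Gc y0 Gt[OF PCy] Gy assoc_mult_mat_vec[of "transpose_mat G" q p G q, OF _ Gc y0]
    by (subst add_mult_distrib_mat_vec[of _ q q]) (auto simp: \<mu>y)
  moreover have Zc': "transpose_mat Z *\<^sub>v w \<in> carrier_vec q" for w
    using Z by (auto intro: carrier_vecI)
  have diff_add: "x - (w + z) = x - w - z"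
    if "x \<in> carrier_vec q" "w \<in> carrier_vec q" "z \<in> carrier_vec q" for x w z :: "real vec"
    using that by (intro eq_vecI) auto
  moreover have "P *\<^sub>v rhat = P *\<^sub>v g - P *\<^sub>v (C *\<^sub>v y)"
    unfolding rhat_def using mult_minus_distrib_mat_vec[OF P(1) g, of "C *\<^sub>v y"] C y by auto
  then have "transpose_mat Z *\<^sub>v (transpose_mat B *\<^sub>v (P *\<^sub>v rhat)) =
     transpose_mat Z *\<^sub>v (transpose_mat B *\<^sub>v (P *\<^sub>v g))
     - transpose_mat Z *\<^sub>v (transpose_mat B *\<^sub>v (P *\<^sub>v (C *\<^sub>v y)))"
    using mult_minus_distrib_mat_vec[OF Bt Pg PCy] 
      mult_minus_distrib_mat_vec[OF Z(2), of "transpose_mat B *\<^sub>v (P *\<^sub>v g)" "transpose_mat B *\<^sub>v (P *\<^sub>v (C *\<^sub>v y))"] Bt Pg PCy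
    by (metis mult_mat_vec_carrier)
  ultimately have "transpose_mat G *\<^sub>v (transpose_mat T *\<^sub>v (P *\<^sub>v g))
      - (transpose_mat G * G + \<mu> \<cdot>\<^sub>m 1\<^sub>m q) *\<^sub>v (y @\<^sub>v 0\<^sub>v q2)
    = transpose_mat Z *\<^sub>v (transpose_mat B *\<^sub>v (P *\<^sub>v rhat)) - \<mu> \<cdot>\<^sub>v (y @\<^sub>v 0\<^sub>v q2)"
    unfolding Gt[OF Pg] using diff_add[of "transpose_mat Z *\<^sub>v (transpose_mat B *\<^sub>v (P *\<^sub>v g))"
        "transpose_mat Z *\<^sub>v (transpose_mat B *\<^sub>v (P *\<^sub>v (C *\<^sub>v y)))" "\<mu> \<cdot>\<^sub>v (y @\<^sub>v 0\<^sub>v q2)"]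
      Zc' y0 by (simp only: smult_carrier_vec)
  also have "transpose_mat Z *\<^sub>v (transpose_mat B *\<^sub>v (P *\<^sub>v rhat)) =
      (transpose_mat Q *\<^sub>v (transpose_mat B *\<^sub>v (P *\<^sub>v rhat)))
      @\<^sub>v (transpose_mat Zc *\<^sub>v (transpose_mat B *\<^sub>v (P *\<^sub>v rhat)))"
    unfolding Z_def by (rule transpose_hcat_mult[OF Q(1,2)]) (use Bt Pr in auto)
  \<comment> \<open>The upper block is cancelled by the regularization term, by \<open>Q\<^sup>T B\<^sup>T = C\<^sup>T P\<^sup>T\<close> and the small
    normal equations.\<close>
  also have "transpose_mat Q *\<^sub>v (transpose_mat B *\<^sub>v (P *\<^sub>v rhat)) = \<mu> \<cdot>\<^sub>v y"
  proof -
    have Pt: "transpose_mat P \<in> carrier_mat p1 p" using P by simp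
    have PtP: "transpose_mat P * P = 1\<^sub>m p1"
      using orthogonal_matrix_hcatD[OF P] P by (auto simp: orthonormal_cols_def)
    have "transpose_mat Q * transpose_mat B = transpose_mat C * transpose_mat P"
      using transpose_mult[OF B Q(1)] transpose_mult[OF P(1) C(1)] C(2) by simp
    then have "transpose_mat Q *\<^sub>v (transpose_mat B *\<^sub>v (P *\<^sub>v rhat))
        = transpose_mat C *\<^sub>v (transpose_mat P *\<^sub>v (P *\<^sub>v rhat))"
      using assoc_mult_mat_vec[of "transpose_mat Q" q1 q "transpose_mat B" p, OF _ Bt Pr]
       assoc_mult_mat_vec[of "transpose_mat C" q1 p1 "transpose_mat P" p, OF _ Pt Pr] Q C by simp
    also have "transpose_mat P *\<^sub>v (P *\<^sub>v rhat) = rhat"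
      using assoc_mult_mat_vec[OF Pt P(1) rhat] PtP rhat by simp
    finally show ?thesis using normal by (simp add: rhat_def)
  qed
  also have "transpose_mat Zc *\<^sub>v (transpose_mat B *\<^sub>v (P *\<^sub>v rhat))
      = (transpose_mat Zc * transpose_mat B * P) *\<^sub>v rhat"
  proof -
    have Zct: "transpose_mat Zc \<in> carrier_mat q2 q" using Q by simp
    show ?thesis
      using assoc_mult_mat_vec[OF Zct Bt Pr] assoc_mult_mat_vec[OF mult_carrier_mat[OF Zct Bt] P(1) rhat] by simp
  qed
  also have "(\<mu> \<cdot>\<^sub>v y @\<^sub>v (transpose_mat Zc * transpose_mat B * P) *\<^sub>v rhat) - \<mu> \<cdot>\<^sub>v (y @\<^sub>v 0\<^sub>v q2)
      = 0\<^sub>v q1 @\<^sub>v ((transpose_mat Zc * transpose_mat B * P) *\<^sub>v rhat)"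
    by (rule cancel) (use Q in \<open>auto intro: carrier_vecI\<close>)
  finally show ?thesis unfolding T_def rhat_def .
qed

lemma hcat_single_col_mult_unit:
  assumes "X \<in> carrier_mat p n" "x \<in> carrier_vec p"
  shows "(X ||| mat_of_cols p [x]) *\<^sub>v unit_vec (n+1) n = x"
proof -
  have c: "X ||| mat_of_cols p [x] \<in> carrier_mat p (n+1)"
    by (rule hcat_carrier[OF assms(1)]) (use mat_of_cols_carrier(1)[of p "[x]"] in simp)
  then have "(X ||| mat_of_cols p [x]) *\<^sub>v unit_vec (n+1) n = col (X ||| mat_of_cols p [x]) n"
    by (intro mult_unit_vec) auto
  also have "\<dots> = x" using assms c by (intro eq_vecI) (auto simp: hcat_def mat_of_cols_index)
  finally show ?thesis .
qed

lemma vnorm_zero_append: "vnorm (0\<^sub>v n @\<^sub>v x) = vnorm x"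
  unfolding vnorm_def by (subst scalar_prod_append[of _ n _ "dim_vec x"]) (auto intro: carrier_vecI)

theorem theorem3p4:
  fixes A Wp W Y R T1 T2 Tc Z1 Z2 Zc T Z V Vm U B Vt Ut Bt Bh G :: "real mat"
    and b x1 xc r1 zeta g y rhat r :: "real vec"
    and M N k l m :: nat and lam :: real
    and u v ut vt :: "nat \<Rightarrow> real vec" and \<alpha> \<beta> \<alpha>t \<beta>t :: "nat \<Rightarrow> real"
  assumes A: "A \<in> carrier_mat M N" and b: "b \<in> carrier_vec M"
    and l: "1 \<le> l" and k: "1 \<le> k" "k \<le> m" and lam: "0 \<le> lam"
    \<comment> \<open>standard GKB\<close>
    and gkb: "gkb A b (m+l) u v \<alpha> \<beta>"
    and V: "V = seq_cols N v (m+l)" and Vm: "Vm = seq_cols N v m"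
    and U: "U = seq_cols M u (m+l+1)" and B: "B = lower_bidiag \<alpha> \<beta> (m+l)"
    \<comment> \<open>recycling GKB\<close>
    and Wp: "Wp \<in> carrier_mat N (k-1)" "orthonormal_cols Wp" "col_range Wp \<subseteq> col_range Vm"
    and x1: "x1 \<in> col_range Vm" "x1 \<notin> col_range Wp"
    and xc: "xc = new_direction Wp x1"
    and W: "W = Wp ||| mat_of_cols N [xc]"
    and qr: "skinny_qr (A * W) Y R"
    and r1: "r1 = b - A *\<^sub>v xc" and zeta: "zeta = transpose_mat Y *\<^sub>v r1"
    and rgkb: "recycling_gkb A Y r1 l ut vt \<alpha>t \<beta>t"
    and Vt: "Vt = seq_cols N vt l" and Ut: "Ut = seq_cols M ut (l+1)"
    and Bt: "Bt = lower_bidiag \<alpha>t \<beta>t l"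
    and Bh: "Bh = recycled_mat A Y R Vt Bt"
    \<comment> \<open>orthogonal matrices\<close>
    and T12c: "T1 \<in> carrier_mat (m+l+1) k" "T2 \<in> carrier_mat (m+l+1) (l+1)"
      "Tc \<in> carrier_mat (m+l+1) (m-k)"
    and T: "T = T1 ||| T2 ||| Tc" "orthogonal_matrix (m+l+1) T" "Y = U * T1" "Ut = U * T2"
    and Z12c: "Z1 \<in> carrier_mat (m+l) k" "Z2 \<in> carrier_mat (m+l) l"
      "Zc \<in> carrier_mat (m+l) (m-k)"
    and Z: "Z = Z1 ||| Z2 ||| Zc" "orthogonal_matrix (m+l) Z" "W = V * Z1" "Vt = V * Z2"
    \<comment> \<open>residuals\<close>
    and g: "g = (zeta + R *\<^sub>v unit_vec k (k-1)) @\<^sub>v (\<beta>t 1 \<cdot>\<^sub>v unit_vec (l+1) 0)"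
    and y: "tikhonov_minimizer Bh g lam y"
    and rhat: "rhat = g - Bh *\<^sub>v y"
    and G: "G = transpose_mat T * B * Z"
    and r: "r = transpose_mat G *\<^sub>v (transpose_mat T *\<^sub>v (\<beta> 1 \<cdot>\<^sub>v unit_vec (m+l+1) 0))
      - (transpose_mat G * G + lam\<^sup>2 \<cdot>\<^sub>m 1\<^sub>m (m+l)) *\<^sub>v (y @\<^sub>v 0\<^sub>v (m-k))"
  shows "r = 0\<^sub>v (k+l) @\<^sub>v ((transpose_mat Zc * transpose_mat B * (T1 ||| T2)) *\<^sub>v rhat) \<and>
    vnorm r = vnorm ((transpose_mat Zc * transpose_mat B * (T1 ||| T2)) *\<^sub>v rhat)"
proof -
  define n where "n = m + l"
  define P where "P = T1 ||| T2"
  define Q where "Q = Z1 ||| Z2"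
  have n: "m + l = n" "m + l + 1 = n + 1" by (simp_all add: n_def)
  note T12c = T12c[unfolded n] and Z12c = Z12c[unfolded n]
  have Pc: "P \<in> carrier_mat (n+1) (k+(l+1))" unfolding P_def by (rule hcat_carrier[OF T12c(1,2)])
  have Qc: "Q \<in> carrier_mat n (k+l)" unfolding Q_def by (rule hcat_carrier[OF Z12c(1,2)])
  have T': "T = P ||| Tc" unfolding T(1) P_def by (rule hcat_assoc[OF T12c])
  have Z': "Z = Q ||| Zc" unfolding Z(1) Q_def by (rule hcat_assoc[OF Z12c])
  have Uc: "U \<in> carrier_mat M (n+1)" and Vc: "V \<in> carrier_mat N n" unfolding U V n by simp_all
  have Bc: "B \<in> carrier_mat (n+1) n" unfolding B n by (rule lower_bidiag_carrier)
  have Vtc: "Vt \<in> carrier_mat N l" and Utc: "Ut \<in> carrier_mat M (l+1)" unfolding Vt Ut by simp_all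
  have Btc: "Bt \<in> carrier_mat (l+1) l" unfolding Bt by (rule lower_bidiag_carrier)
  have Wc: "W \<in> carrier_mat N k" unfolding Z(3) by (rule mult_carrier_mat[OF Vc Z12c(1)])
  have AWc: "A * W \<in> carrier_mat M k" by (rule mult_carrier_mat[OF A Wc])
  then have dAW: "dim_row (A * W) = M" "dim_col (A * W) = k" by (rule carrier_matD)+
  have Yc: "Y \<in> carrier_mat M k" and Rc: "R \<in> carrier_mat k k" and AW: "A * W = Y * R"
    using qr unfolding skinny_qr_def dAW by blast+
  have Ytc: "transpose_mat Y \<in> carrier_mat k M" using Yc by simp
  have Hc: "transpose_mat Y * A * Vt \<in> carrier_mat k l"
    by (rule mult_carrier_mat[OF mult_carrier_mat[OF Ytc A] Vtc])
  have Bh': "Bh = four_block_mat R (transpose_mat Y * A * Vt) (0\<^sub>m (l+1) k) Bt"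
    unfolding Bh recycled_mat_def carrier_matD[OF Btc] carrier_matD[OF Rc] ..
  have Bhc: "Bh \<in> carrier_mat (k+(l+1)) (k+l)" unfolding Bh' using Rc Btc by (rule four_block_carrier_mat)
  have orthU: "orthonormal_cols U" unfolding U n by (rule gkb_left_orthonormal[OF A gkb[unfolded n]])
  have AV: "A * V = U * B" unfolding U V B n by (rule gkb_factorization[OF A gkb[unfolded n]])
  have AVt: "A * Vt = Y * (transpose_mat Y * A * Vt) + Ut * Bt"
    unfolding Vt Ut Bt by (rule recycling_gkb_factorization[OF A Yc rgkb])
  have UP: "U * P = Y ||| Ut" unfolding P_def T(3,4) by (rule mult_hcat[OF Uc T12c(1,2)])
  have VQ: "V * Q = W ||| Vt" unfolding Q_def Z(3,4) by (rule mult_hcat[OF Vc Z12c(1,2)])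

  \<comment> \<open>The recycled matrix represents \<open>B\<close> on the range of \<open>Q\<close>: compare after multiplication with \<open>U\<close>.\<close>
  have "U * (B * Q) = A * (V * Q)"
    using assoc_mult_mat[OF Uc Bc Qc] assoc_mult_mat[OF A Vc Qc] AV by simp
  also have "\<dots> = A * W ||| A * Vt" unfolding VQ by (rule mult_hcat[OF A Wc Vtc])
  also have "\<dots> = (Y ||| Ut) * Bh"
  proof -
    have "(Y ||| Ut) * Bh = (Y * R + Ut * 0\<^sub>m (l+1) k) ||| (Y * (transpose_mat Y * A * Vt) + Ut * Bt)"
      unfolding Bh' by (rule hcat_mult_four_block[OF Yc Utc Rc Hc zero_carrier_mat Btc])
    also have "Y * R + Ut * 0\<^sub>m (l+1) k = Y * R" using Yc Rc Utc by simp
    finally show ?thesis by (simp only: AW AVt)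
  qed
  also have "\<dots> = U * (P * Bh)"
    using assoc_mult_mat[OF Uc Pc Bhc] UP by simp
  finally have BQ: "B * Q = P * Bh"
    using orthonormal_cols_cancel[OF Uc orthU, of "B * Q" "k+l" "P * Bh"] Bc Qc Pc Bhc by simp

  \<comment> \<open>The recycled right-hand side represents \<open>b\<close>, in the same way. The term \<open>R e\<^sub>k\<close> in \<open>g\<close> restores
    the vector \<open>A xc\<close> that was subtracted to form \<open>r1\<close>.\<close>
  have xcc: "xc \<in> carrier_vec N"
    unfolding xc new_direction_def Let_def using Wp by (auto intro!: carrier_vecI)
  have Wek: "W *\<^sub>v unit_vec k (k-1) = xc"
    using hcat_single_col_mult_unit[OF Wp(1) xcc] k(1) W by simp
  have r1c: "r1 \<in> carrier_vec M" unfolding r1 using A b xcc by auto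
  have zetac: "zeta \<in> carrier_vec k" unfolding zeta by (rule mult_mat_vec_carrier[OF Ytc r1c])
  have Rek: "R *\<^sub>v unit_vec k (k-1) \<in> carrier_vec k" by (rule mult_mat_vec_carrier[OF Rc unit_vec_carrier])
  have gc: "g \<in> carrier_vec (k+(l+1))" unfolding g using zetac Rek by (intro append_carrier_vec) auto
  have "ut 1 \<in> carrier_vec (dim_row A) \<and> \<beta>t 1 > 0"
    and ut1_eq: "ut 1 = (1 / \<beta>t 1) \<cdot>\<^sub>v (r1 - Y *\<^sub>v zeta)"
    using rgkb unfolding recycling_gkb_def Let_def zeta by (fastforce, blast)
  then have ut1: "ut 1 \<in> carrier_vec M" and "\<beta>t 1 \<noteq> 0" using A by auto
  then have bt: "\<beta>t 1 \<cdot>\<^sub>v ut 1 = r1 - Y *\<^sub>v zeta" unfolding ut1_eq by (simp add: smult_smult_assoc)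
  have "u 1 \<in> carrier_vec (dim_row A) \<and> \<beta> 1 > 0" and u1_eq: "u 1 = (1 / \<beta> 1) \<cdot>\<^sub>v b"
    using gkb unfolding gkb_def by (fastforce, blast)
  then have u1: "u 1 \<in> carrier_vec M" and "\<beta> 1 \<noteq> 0" using A by auto
  then have b1: "\<beta> 1 \<cdot>\<^sub>v u 1 = b" unfolding u1_eq by (simp add: smult_smult_assoc)
  have Yz: "Y *\<^sub>v zeta \<in> carrier_vec M" using Yc by (auto intro: carrier_vecI)
  have YR: "Y *\<^sub>v (R *\<^sub>v unit_vec k (k-1)) = A *\<^sub>v xc"
    using assoc_mult_mat_vec[OF Yc Rc unit_vec_carrier, of "k-1"]
      assoc_mult_mat_vec[OF A Wc unit_vec_carrier, of "k-1"] AW Wek by simp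
  have "U *\<^sub>v (P *\<^sub>v g) = (Y ||| Ut) *\<^sub>v g"
    using assoc_mult_mat_vec[OF Uc Pc gc] UP by simp
  also have "\<dots> = Y *\<^sub>v (zeta + R *\<^sub>v unit_vec k (k-1)) + Ut *\<^sub>v (\<beta>t 1 \<cdot>\<^sub>v unit_vec (l+1) 0)"
    unfolding g using zetac Rek by (intro hcat_mult_append[OF Yc Utc]) auto
  also have "Y *\<^sub>v (zeta + R *\<^sub>v unit_vec k (k-1)) = Y *\<^sub>v zeta + A *\<^sub>v xc"
    using mult_add_distrib_mat_vec[OF Yc zetac Rek] YR by simp
  also have "Ut *\<^sub>v (\<beta>t 1 \<cdot>\<^sub>v unit_vec (l+1) 0) = \<beta>t 1 \<cdot>\<^sub>v ut 1"
    using mult_mat_vec[OF Utc unit_vec_carrier, of "\<beta>t 1" 0] seq_cols_mult_unit_vec[of 0 "l+1" ut M] ut1 Ut by simp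
  also have "Y *\<^sub>v zeta + A *\<^sub>v xc + \<beta>t 1 \<cdot>\<^sub>v ut 1 = b"
    unfolding bt unfolding r1 using Yz Yc A xcc b by (intro eq_vecI) auto
  also have "b = U *\<^sub>v (\<beta> 1 \<cdot>\<^sub>v unit_vec (n+1) 0)"
    using mult_mat_vec[OF Uc unit_vec_carrier, of "\<beta> 1" 0] seq_cols_mult_unit_vec[of 0 "n+1" u M] u1 U b1 n by simp
  finally have Pg: "P *\<^sub>v g = \<beta> 1 \<cdot>\<^sub>v unit_vec (n+1) 0"
    by (rule orthonormal_cols_cancel_vec[OF Uc orthU mult_mat_vec_carrier[OF Pc gc]
          smult_carrier_vec[THEN iffD2, OF unit_vec_carrier]])

  have yc: "y \<in> carrier_vec (k+l)"
    using y Bhc by (auto simp: tikhonov_minimizer_def is_arg_min_linorder)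
  note main = residual_of_embedded_minimizer[OF Bc Pc T12c(3) T(2)[unfolded n T'] Qc Z12c(3)
    Z(2)[unfolded n Z'] Bhc BQ gc yc tikhonov_normal_equations[OF Bhc gc y] G[unfolded T' Z']]
  have "r = 0\<^sub>v (k+l) @\<^sub>v ((transpose_mat Zc * transpose_mat B * P) *\<^sub>v rhat)"
    unfolding r n Pg[symmetric] rhat T' by (rule main)
  then show ?thesis unfolding P_def by (simp add: vnorm_zero_append)
qed

end
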